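(* Let $q$ be a prime power, $d\ge 2$ an integer and $f=x^d\in\mathbb{F}_q[x]$. Then \[\deg(S_f)\le \max\Big(\gcd(d,q-1),\ 1+\gcd(d-1,q-1),\ \big\lfloor \tfrac12+\sqrt{q-1}\big\rfloor\Big).\] In particular, if $\lfloor \frac12+\sqrt{q-1}\rfloor\le \max(\gcd(d,q-1),1+\gcd(d-1,q-1))$, then $\deg(S_f)=\max(\gcd(d,q-1),1+\gcd(d-1,q-1))$.
   Context: $\mathrm{PG}(2,q)$ is the projective plane over $\mathbb{F}_q$. For $f\in\mathbb{F}_q[x]$, $S_f=\{(x,f(x),1):x\in\mathbb{F}_q\}\cup\{(0,1,0)\}$. For a set $D$ of $q+1$ points, $u_i(D)$ is the number of lines of $\mathrm{PG}(2,q)$ containing exactly $i$ points of $D$, and $\deg(D)$ is the largest $i$ with $u_i(D)\neq 0$. *)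

theory Defs
  imports "HOL-Analysis.Analysis" "HOL-Computational_Algebra.Polynomial"
begin

text \<open>
  The projective plane over a field: points and lines are the subspaces of dimension 1 and 2 of the
  three-dimensional coordinate space; a point lies on a line iff it is contained in it.
\<close>

definition pg_points :: "('a::field ^ 3) set set" where
  "pg_points = {P. vec.subspace P \<and> vec.dim P = 1}"

definition pg_lines :: "('a::field ^ 3) set set" where
  "pg_lines = {l. vec.subspace l \<and> vec.dim l = 2}"

definition pg_pt :: "'a::field \<Rightarrow> 'a \<Rightarrow> 'a \<Rightarrow> ('a ^ 3) set" where
  "pg_pt x y z = vec.span {vector [x, y, z]}"

definition S_set :: "'a::field poly \<Rightarrow> ('a ^ 3) set set" where
  "S_set f = {pg_pt x (poly f x) 1 | x. True} \<union> {pg_pt 0 1 0}"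

definition u_num :: "nat \<Rightarrow> ('a::field ^ 3) set set \<Rightarrow> nat" where
  "u_num i D = card {l \<in> pg_lines. card {P \<in> D. P \<subseteq> l} = i}"

text \<open>
  Over a finite field the maximum below is taken over a finite nonempty set
  (\<open>finite_u_num_nonzero\<close>, \<open>u_num_nonzero_nonempty\<close>).
\<close>

definition deg_set :: "('a::{field,finite} ^ 3) set set \<Rightarrow> nat" where
  "deg_set D = Max {i. u_num i D \<noteq> 0}"

lemma u_num_nonzero_eq:
  fixes D :: "('a::{field,finite} ^ 3) set set"
  shows "{i. u_num i D \<noteq> 0} = (\<lambda>l. card {P \<in> D. P \<subseteq> l}) ` pg_lines"
  by (auto simp: u_num_def)

lemma finite_u_num_nonzero:
  fixes D :: "('a::{field,finite} ^ 3) set set"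
  shows "finite {i. u_num i D \<noteq> 0}"
  unfolding u_num_nonzero_eq by simp

lemma pg_lines_nonempty: "(pg_lines :: ('a::field ^ 3) set set) \<noteq> {}"
proof -
  have "2 \<le> vec.dim (UNIV :: ('a ^ 3) set)"
    by (simp add: card_cart_basis)
  then obtain T :: "('a ^ 3) set" where "vec.subspace T" "vec.dim T = 2"
    using vec.choose_subspace_of_subspace[of 2 "UNIV :: ('a ^ 3) set"] by blast
  then show ?thesis
    by (auto simp: pg_lines_def)
qed

lemma u_num_nonzero_nonempty:
  fixes D :: "('a::{field,finite} ^ 3) set set"
  shows "{i. u_num i D \<noteq> 0} \<noteq> {}"
  unfolding u_num_nonzero_eq using pg_lines_nonempty by simp

lemma pg_pt_in_pg_points:
  assumes "(x, y, z) \<noteq> (0, 0, 0)"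
  shows "pg_pt x y z \<in> pg_points"
proof -
  have "vector [x, y, z] \<noteq> (0 :: 'a ^ 3)"
    using assms by (auto simp: vec_eq_iff forall_3)
  then show ?thesis
    by (simp add: pg_points_def pg_pt_def vec.dim_span vec.subspace_span
        vec.dim_eq_card_independent vec.independent_insert)
qed

lemma pg_pt_eqD:
  assumes "pg_pt x y z = pg_pt x' y' z'"
  obtains c where "x = c * x'" "y = c * y'" "z = c * z'"
proof -
  have "vector [x, y, z] \<in> vec.span {vector [x', y', z'] :: 'a ^ 3}"
    using assms unfolding pg_pt_def by (metis insertI1 vec.span_base)
  then obtain c where "vector [x, y, z] = c *s (vector [x', y', z'] :: 'a ^ 3)"
    by (auto simp: vec.span_singleton)
  then show ?thesis
    using that[of c] by (auto simp: vec_eq_iff forall_3)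
qed

lemma S_set_subset_pg_points: "S_set f \<subseteq> pg_points"
  by (auto simp: S_set_def intro!: pg_pt_in_pg_points)

lemma card_S_set:
  fixes f :: "'a::{field,finite} poly"
  shows "card (S_set f) = CARD('a) + 1"
proof -
  have "inj (\<lambda>x. pg_pt x (poly f x) 1)"
    by (rule injI) (metis pg_pt_eqD mult_1 mult.right_neutral)
  moreover have "pg_pt 0 1 0 \<notin> range (\<lambda>x. pg_pt x (poly f x) 1)"
    by (auto elim!: pg_pt_eqD)
  moreover have "S_set f = insert (pg_pt 0 1 0) (range (\<lambda>x. pg_pt x (poly f x) 1))"
    by (auto simp: S_set_def)
  ultimately show ?thesis
    by (simp add: card_image)
qed

end

theory Submission
  imports Defs
begin

text \<open>
  A line that contains a large part of \<open>S\<^sub>f\<close> has the form \<open>y = m x + b\<close>, so it meets \<open>S\<^sub>f\<close> in the roots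
  of \<open>x\<^sup>d = m x + b\<close>. If \<open>m = 0\<close> or \<open>b = 0\<close> this amounts to counting roots of unity. If
  \<open>m, b \<noteq> 0\<close>, then for each \<open>u \<noteq> 1\<close> at most one root \<open>x\<close> has \<open>u x\<close> as another root: eliminating
  \<open>x\<^sup>d\<close> gives \<open>m (u\<^sup>d - u) x = b (1 - u\<^sup>d)\<close>, and \<open>u\<^sup>d - u\<close> and \<open>1 - u\<^sup>d\<close> do not both vanish. Hence \<open>k\<close>
  roots have \<open>k (k - 1)\<close> distinct quotients different from \<open>0\<close> and \<open>1\<close>, so \<open>k (k - 1) \<le> q - 2\<close>.
\<close>

section \<open>Powers and roots of unity in a finite field\<close>

lemma finite_field_power_card_minus_1:
  fixes x :: "'a::{field,finite}"
  assumes "x \<noteq> 0"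
  shows "x ^ (CARD('a) - 1) = 1"
proof -
  \<comment> \<open>Multiplication by \<open>x\<close> permutes the nonzero elements; cancelling
    their product then leaves the power of \<open>x\<close>.\<close>
  have "(\<Prod>y\<in>-{0}. x * y) = \<Prod>(-{0::'a})"
    using assms by (intro prod.reindex_bij_witness[of _ "\<lambda>y. y / x" "\<lambda>y. x * y"]) auto
  then have "x ^ card (-{0::'a}) * \<Prod>(-{0::'a}) = \<Prod>(-{0::'a})"
    by (simp add: prod.distrib)
  moreover have "\<Prod>(-{0::'a}) \<noteq> 0"
    by simp
  ultimately show ?thesis
    by (simp add: Compl_eq_Diff_UNIV card_Diff_subset)
qed

lemma card_power_eq_1_le:
  assumes "n > 0"
  shows "card {x::'a::{field,finite}. x ^ n = 1} \<le> n"
proof -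
  let ?p = "monom (1::'a) n - 1"
  have deg: "degree ?p \<le> n"
    by (intro degree_diff_le) (auto simp: degree_monom_eq)
  have "coeff ?p n = 1"
    using assms by simp
  then have "?p \<noteq> 0"
    by (metis coeff_0 zero_neq_one)
  then have "card {x. poly ?p x = 0} \<le> degree ?p"
    by (rule card_poly_roots_bound)
  also have "{x. poly ?p x = 0} = {x. x ^ n = 1}"
    by (simp add: poly_monom)
  finally show ?thesis
    using deg by linarith
qed

text \<open>With \<open>q - 1 = n * k\<close>, the polynomial \<open>X^(q-1) - 1\<close> factors as
  \<open>(X^n - 1) * h\<close>. All \<open>q - 1\<close> nonzero elements are roots of the product
  and \<open>h\<close> has at most \<open>n * (k - 1)\<close> roots, so at least \<open>n\<close>
  are left for \<open>X^n - 1\<close>.\<close>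

lemma card_power_eq_1_dvd:
  assumes "n dvd CARD('a::{field,finite}) - 1"
  shows "card {x::'a. x ^ n = 1} = n"
proof -
  let ?q = "CARD('a)"
  have q: "?q \<ge> 2"
    using card_mono[of UNIV "{0, 1::'a}"] by simp
  obtain k where k: "?q - 1 = n * k"
    using assms by blast
  have pos: "n > 0" "k > 0"
    using q k by (auto intro!: Nat.gr0I)
  define h where "h = (\<Sum>i<k. monom (1::'a) (n * i))"
  \<comment> \<open>As \<open>n > 0\<close>, only the summand \<open>i = 0\<close> has a constant
    term; hence \<open>h\<close> is nonzero and its degree bounds its roots.\<close>
  have "coeff h 0 = (\<Sum>i<k. if i = 0 then 1 else 0)"
    unfolding h_def using pos by (simp add: coeff_sum if_distrib cong: if_cong)
  then have "coeff h 0 = 1"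
    using pos by simp
  then have "h \<noteq> 0"
    by (metis coeff_0 zero_neq_one)
  then have "card {x. poly h x = 0} \<le> degree h"
    by (rule card_poly_roots_bound)
  also have "degree h \<le> n * (k - 1)"
    unfolding h_def by (intro degree_sum_le) (auto simp: degree_monom_eq)
  finally have h_roots: "card {x. poly h x = 0} \<le> n * (k - 1)" .
  have "-{0} \<subseteq> {x::'a. x ^ n = 1} \<union> {x. poly h x = 0}"
  proof
    fix x :: 'a
    assume "x \<in> -{0}"
    then have "(x ^ n) ^ k = 1"
      using finite_field_power_card_minus_1[of x] k by (simp add: power_mult)
    moreover have "poly h x = (\<Sum>i<k. (x ^ n) ^ i)"
      by (simp add: h_def poly_sum poly_monom power_mult)
    ultimately have "(x ^ n - 1) * poly h x = 0"
      using power_diff_1_eq[of "x ^ n" k] by simp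
    then show "x \<in> {x. x ^ n = 1} \<union> {x. poly h x = 0}"
      by auto
  qed
  then have "card (-{0::'a}) \<le> card ({x::'a. x ^ n = 1} \<union> {x. poly h x = 0})"
    by (intro card_mono) auto
  also have "\<dots> \<le> card {x::'a. x ^ n = 1} + n * (k - 1)"
    using card_Un_le[of "{x::'a. x ^ n = 1}" "{x. poly h x = 0}"] h_roots by linarith
  also have "card (-{0::'a}) = n * k"
    using k by (simp add: Compl_eq_Diff_UNIV card_Diff_subset)
  finally have "n \<le> card {x::'a. x ^ n = 1}"
    using pos by (cases k) auto
  then show ?thesis
    using card_power_eq_1_le[OF pos(1), where 'a='a] by linarith
qed

text \<open>Since every nonzero \<open>x\<close> satisfies \<open>x^(q-1) = 1\<close>, Bezout lets
  the exponent \<open>n\<close> be replaced by its gcd with \<open>q - 1\<close>, which divides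
  \<open>q - 1\<close>.\<close>

lemma card_roots_of_unity_finite_field:
  assumes "n > 0"
  shows "card {x::'a::{field,finite}. x ^ n = 1} = gcd n (CARD('a) - 1)"
proof -
  let ?g = "gcd n (CARD('a) - 1)"
  have "x ^ n = 1 \<longleftrightarrow> x ^ ?g = 1" for x :: 'a
  proof
    assume x: "x ^ n = 1"
    then have "x \<noteq> 0"
      using assms by (auto simp: power_0_left)
    then have y: "x ^ (CARD('a) - 1) = 1"
      by (rule finite_field_power_card_minus_1)
    obtain a b where "n * a = (CARD('a) - 1) * b + ?g"
      using bezout_nat[of n "CARD('a) - 1"] assms by blast
    then have "(x ^ n) ^ a = (x ^ (CARD('a) - 1)) ^ b * x ^ ?g"
      by (metis power_add power_mult)
    then show "x ^ ?g = 1"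
      by (simp only: x y power_one mult_1)
  next
    assume "x ^ ?g = 1"
    moreover obtain k where "n = ?g * k"
      by (meson dvdE gcd_dvd1)
    ultimately show "x ^ n = 1"
      by (metis power_mult power_one)
  qed
  then show ?thesis
    using card_power_eq_1_dvd[of ?g, where 'a='a] by simp
qed

text \<open>The solution set is empty or a coset of the \<open>n\<close>-th roots of unity: dividing
  by one solution maps it injectively into them.\<close>

lemma card_power_eq_const_le:
  fixes b :: "'a::{field,finite}"
  assumes "n > 0" "b \<noteq> 0"
  shows "card {x. x ^ n = b} \<le> gcd n (CARD('a) - 1)"
proof (cases "\<exists>y. y ^ n = b")
  case True
  then obtain y where y: "y ^ n = b"
    by blast
  then have "y \<noteq> 0"
    using assms by (auto simp: power_0_left)
  then have "card {x. x ^ n = b} \<le> card {x::'a. x ^ n = 1}"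
    using y assms by (intro card_inj_on_le[of "\<lambda>x. x / y"]) (auto simp: inj_on_def power_divide)
  then show ?thesis
    using card_roots_of_unity_finite_field[OF assms(1), where 'a='a] by simp
qed simp

section \<open>Roots of \<open>x^d = m * x + b\<close>\<close>

lemma card_trinomial_roots:
  fixes m b :: "'a::{field,finite}"
  assumes "m \<noteq> 0" "b \<noteq> 0" "d > 0"
  defines "k \<equiv> card {x. x ^ d = m * x + b}"
  shows "k * (k - 1) \<le> CARD('a) - 2"
proof -
  define R where "R = {x. x ^ d = m * x + b}"
  have nz: "x \<noteq> 0" if "x \<in> R" for x
    using that assms by (auto simp: R_def power_0_left)
  have ratio: "x = x'"
    if "x \<in> R" "x' \<in> R" "u * x \<in> R" "u * x' \<in> R" "u \<noteq> 1" for u x x'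
  proof -
    \<comment> \<open>Compare the equation at \<open>u * z\<close> with \<open>u^d\<close> times the
      equation at \<open>z\<close>.\<close>
    have *: "m * (u ^ d - u) * z = b * (1 - u ^ d)" if "z \<in> R" "u * z \<in> R" for z
    proof -
      have "u ^ d * (m * z + b) = m * (u * z) + b"
        using that by (simp add: R_def power_mult_distrib)
      then show ?thesis
        by (simp add: algebra_simps)
    qed
    \<comment> \<open>Otherwise the identity reads \<open>0 = b * (1 - u)\<close>, against
      \<open>b \<noteq> 0\<close> and \<open>u \<noteq> 1\<close>.\<close>
    have "u ^ d \<noteq> u"
      using *[of x] that assms(2) by auto
    moreover have "m * (u ^ d - u) * x = m * (u ^ d - u) * x'"
      using *[of x] *[of x'] that by simp
    ultimately show ?thesis
      using assms(1) by simp
  qed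
  let ?P = "Sigma R (\<lambda>x. R - {x})"
  have "inj_on (\<lambda>(x, y). y / x) ?P"
  proof (rule inj_onI)
    fix p p'
    assume "p \<in> ?P" "p' \<in> ?P" "(\<lambda>(x, y). y / x) p = (\<lambda>(x, y). y / x) p'"
    then obtain x y x' y' where p: "p = (x, y)" "p' = (x', y')"
      and xy: "x \<in> R" "y \<in> R" "y \<noteq> x" "x' \<in> R" "y' \<in> R" "y' \<noteq> x'"
      and eq: "y / x = y' / x'"
      by auto
    define u where "u = y / x"
    have "y = u * x" "y' = u * x'" "u \<noteq> 1"
      using xy eq nz unfolding u_def by (auto simp: field_simps)
    then show "p = p'"
      using ratio[of x x' u] xy p by simp
  qed
  moreover have "(\<lambda>(x, y). y / x) ` ?P \<subseteq> -{0, 1}"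
    using nz by auto
  ultimately have "card ?P \<le> card (-{0, 1::'a})"
    by (intro card_inj_on_le) auto
  moreover have "card ?P = k * (k - 1)"
    by (simp add: k_def R_def[symmetric])
  ultimately show ?thesis
    by (simp add: Compl_eq_Diff_UNIV card_Diff_subset)
qed

text \<open>Completing the square gives \<open>(k - 1/2)^2 \<le> q - 7/4\<close>, which is below
  \<open>q - 1\<close>. The case \<open>k = 0\<close> is separate because \<open>k - 1\<close> is
  truncated there.\<close>

lemma le_floor_half_plus_sqrt:
  fixes k q :: nat
  assumes "k * (k - 1) \<le> q - 2" "q \<ge> 2"
  shows "int k \<le> \<lfloor>1 / 2 + sqrt (real q - 1)\<rfloor>"
proof (cases k)
  case (Suc j)
  have "real (k * j) \<le> real (q - 2)"
    using assms(1) Suc by (metis diff_Suc_1 of_nat_le_iff)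
  then have "(real k - 1 / 2)\<^sup>2 \<le> real q - 1"
    using Suc assms(2) by (simp add: power2_eq_square algebra_simps of_nat_diff)
  then have "real k - 1 / 2 \<le> sqrt (real q - 1)"
    by (rule real_le_rsqrt)
  then show ?thesis
    by (simp add: le_floor_iff)
qed (use assms in simp)

lemma card_power_eq_linear_le:
  fixes m b :: "'a::{field,finite}"
  assumes "d \<ge> 2"
  shows "int (card {x. x ^ d = m * x + b})
    \<le> max (int (max (gcd d (CARD('a) - 1)) (1 + gcd (d - 1) (CARD('a) - 1))))
          \<lfloor>1 / 2 + sqrt (real CARD('a) - 1)\<rfloor>"
proof -
  consider "m = 0" "b \<noteq> 0" | "b = 0" | "m \<noteq> 0" "b \<noteq> 0"
    by blast
  then show ?thesis
  proof cases
    case 1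
    then show ?thesis
      using card_power_eq_const_le[of d b] assms by simp
  next
    case 2
    have "d = Suc (d - 1)"
      using assms by simp
    then have pow: "x ^ d = x * x ^ (d - 1)" for x :: 'a
      by (metis power_Suc)
    \<comment> \<open>For \<open>b = 0\<close> a factor \<open>x\<close> splits off. If also
      \<open>m = 0\<close>, the only root is 0; otherwise \<open>m\<close> is a nonzero constant, as
      the count of \<open>(d-1)\<close>-th powers requires.\<close>
    have "{x. x ^ d = m * x + b} \<subseteq> insert 0 (if m = 0 then {} else {x. x ^ (d - 1) = m})"
      using 2 assms by (auto simp: pow power_0_left)
    then have "card {x. x ^ d = m * x + b}
        \<le> card (insert 0 (if m = 0 then {} else {x. x ^ (d - 1) = m}))"
      by (intro card_mono) auto
    also have "\<dots> \<le> 1 + card (if m = 0 then {} else {x. x ^ (d - 1) = m})"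
      by (simp add: card_insert_if)
    also have "\<dots> \<le> 1 + gcd (d - 1) (CARD('a) - 1)"
      using card_power_eq_const_le[of "d - 1" m] assms by simp
    finally show ?thesis
      by linarith
  next
    case 3
    have "CARD('a) \<ge> 2"
      using card_mono[of UNIV "{0, 1::'a}"] by simp
    then have "int (card {x. x ^ d = m * x + b}) \<le> \<lfloor>1 / 2 + sqrt (real CARD('a) - 1)\<rfloor>"
      using assms by (intro le_floor_half_plus_sqrt card_trinomial_roots 3) auto
    then show ?thesis
      by linarith
  qed
qed

section \<open>Equations of lines and their intersections with \<open>S_set f\<close>\<close>

lemma pg_pt_subset_iff:
  assumes "vec.subspace l"
  shows "pg_pt x y z \<subseteq> l \<longleftrightarrow> vector [x, y, z] \<in> l"
proof
  show "vector [x, y, z] \<in> l" if "pg_pt x y z \<subseteq> l"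
    using that vec.span_base[of "vector [x, y, z]" "{vector [x, y, z]}"] by (auto simp: pg_pt_def)
  show "pg_pt x y z \<subseteq> l" if "vector [x, y, z] \<in> l"
    unfolding pg_pt_def using that assms by (intro vec.span_minimal) auto
qed

lemma pg_line_normal_vector:
  fixes l :: "('a::field ^ 3) set"
  assumes "l \<in> pg_lines"
  obtains a b c where "(a, b, c) \<noteq> (0, 0, 0)"
    and "\<And>v. v \<in> l \<Longrightarrow> a * v $ 1 + b * v $ 2 + c * v $ 3 = 0"
proof -
  have "vec.dim l = 2"
    using assms by (simp add: pg_lines_def)
  then obtain B where B: "l \<subseteq> vec.span B" "card B = 2"
    using vec.basis_exists[of l] by metis
  then obtain s t where st: "B = {s, t}"
    by (auto simp: card_2_iff)
  \<comment> \<open>The zero third row makes \<open>A\<close> singular; a nonzero kernel vector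
    \<open>w\<close> is orthogonal to \<open>s\<close> and \<open>t\<close>, so its entries are the
    coefficients of an equation of the line.\<close>
  define A :: "'a ^ 3 ^ 3" where "A = vector [s, t, 0]"
  have "det A = 0"
    by (simp add: A_def det_3)
  then have "\<not> (\<exists>B. B ** A = mat 1)"
    by (metis invertible_det_nz invertible_left_inverse)
  then obtain w where w: "A *v w = 0" "w \<noteq> 0"
    unfolding matrix_left_invertible_ker by blast
  let ?H = "{v :: 'a ^ 3. w $ 1 * v $ 1 + w $ 2 * v $ 2 + w $ 3 * v $ 3 = 0}"
  have "vec.subspace ?H"
  proof (rule vec.subspaceI)
    fix x y :: "'a ^ 3"
    assume "x \<in> ?H" "y \<in> ?H"
    then have "(w $ 1 * x $ 1 + w $ 2 * x $ 2 + w $ 3 * x $ 3)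
        + (w $ 1 * y $ 1 + w $ 2 * y $ 2 + w $ 3 * y $ 3) = 0"
      by simp
    then show "x + y \<in> ?H"
      by (simp add: algebra_simps)
  next
    fix c and x :: "'a ^ 3"
    assume "x \<in> ?H"
    then have "c * (w $ 1 * x $ 1 + w $ 2 * x $ 2 + w $ 3 * x $ 3) = 0"
      by simp
    then show "c *s x \<in> ?H"
      by (simp add: algebra_simps)
  qed simp
  moreover have "s \<in> ?H" "t \<in> ?H"
    using w(1) by (auto simp: A_def vec_eq_iff forall_3 matrix_vector_mult_def sum_3 algebra_simps)
  ultimately have "vec.span B \<subseteq> ?H"
    unfolding st by (intro vec.span_minimal) auto
  then have "l \<subseteq> ?H"
    using B(1) by (rule subset_trans[rotated])
  moreover have "(w $ 1, w $ 2, w $ 3) \<noteq> (0, 0, 0)"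
    using w(2) by (auto simp: vec_eq_iff forall_3)
  ultimately show ?thesis
    using that[of "w $ 1" "w $ 2" "w $ 3"] by blast
qed

text \<open>Turns counting points into counting field elements: the last coordinate 1 fixes the
  scalar, so distinct \<open>x\<close> give distinct points, none of them equal to
  \<open>pg_pt 0 1 0\<close>.\<close>

lemma card_S_set_line:
  fixes f :: "'a::{field,finite} poly"
  assumes "vec.subspace l"
  shows "card {P \<in> S_set f. P \<subseteq> l}
    = card {x. vector [x, poly f x, 1] \<in> l} + (if vector [0, 1, 0] \<in> l then 1 else 0)"
proof -
  let ?g = "\<lambda>x. pg_pt x (poly f x) 1"
  let ?X = "{x. vector [x, poly f x, 1] \<in> l}"
  let ?Y = "if vector [0, 1, 0] \<in> l then {pg_pt 0 1 0} else {}"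
  have "inj ?g"
    by (rule injI) (metis pg_pt_eqD mult_1 mult.right_neutral)
  then have "card (?g ` ?X) = card ?X"
    by (meson card_image inj_on_subset subset_UNIV)
  moreover have "?g ` ?X \<inter> ?Y = {}"
    by (auto elim!: pg_pt_eqD)
  moreover have "{P \<in> S_set f. P \<subseteq> l} = ?g ` ?X \<union> ?Y"
  proof -
    have "{P \<in> S_set f. P \<subseteq> l} = ?g ` {x. ?g x \<subseteq> l}
        \<union> (if pg_pt 0 1 0 \<subseteq> l then {pg_pt 0 1 0} else {})"
      unfolding S_set_def by auto
    then show ?thesis
      by (simp only: pg_pt_subset_iff[OF assms])
  qed
  ultimately show ?thesis
    by (simp add: card_Un_disjoint)
qed

lemma card_S_set_monom_line_le:
  fixes l :: "('a::{field,finite} ^ 3) set"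
  assumes "l \<in> pg_lines" "d \<ge> 2"
  shows "int (card {P \<in> S_set (monom 1 d). P \<subseteq> l})
    \<le> max (int (max (gcd d (CARD('a) - 1)) (1 + gcd (d - 1) (CARD('a) - 1))))
          \<lfloor>1 / 2 + sqrt (real CARD('a) - 1)\<rfloor>"
proof -
  let ?X = "{x::'a. vector [x, x ^ d, 1] \<in> l}"
  have card: "card {P \<in> S_set (monom 1 d). P \<subseteq> l}
      = card ?X + (if vector [0, 1, 0] \<in> l then 1 else 0)"
    using card_S_set_line[of l "monom 1 d"] assms(1) by (simp add: pg_lines_def poly_monom)
  obtain a b c where abc: "(a, b, c) \<noteq> (0, 0, 0)"
    and "\<And>v. v \<in> l \<Longrightarrow> a * v $ 1 + b * v $ 2 + c * v $ 3 = 0"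
    using pg_line_normal_vector[OF assms(1)] by blast
  then have l: "a * x + b * y + c * z = 0" if "vector [x, y, z] \<in> l" for x y z
    using that by (metis vector_3)
  show ?thesis
  proof (cases "b = 0")
    case True
    \<comment> \<open>The line is vertical or at infinity. It has at most one affine point of the
      set, so at most 2 points with \<open>pg_pt 0 1 0\<close>, and
      \<open>1 + gcd (d - 1) (q - 1)\<close> is at least 2.\<close>
    have "x = - c / a" if "vector [x, x ^ d, 1] \<in> l" for x
    proof -
      have "a * x + c = 0"
        using l[OF that] True by simp
      moreover from this have "a \<noteq> 0"
        using abc True by auto
      ultimately show ?thesis
        by (simp add: field_simps eq_neg_iff_add_eq_0)
    qed
    then have "?X \<subseteq> {- c / a}"
      by blast
    then have "card ?X \<le> 1"
      using card_mono[of "{- c / a}" ?X] by simp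
    moreover have "gcd (d - 1) (CARD('a) - 1) \<ge> 1"
      using assms(2) by (simp add: Suc_le_eq)
    ultimately show ?thesis
      unfolding card by auto
  next
    case False
    \<comment> \<open>Here the line is the graph of a function with slope \<open>- a / b\<close> and
      intercept \<open>- c / b\<close>, and it misses \<open>pg_pt 0 1 0\<close>.\<close>
    then have "vector [0, 1, 0] \<notin> l"
      using l[of 0 1 0] by auto
    moreover have "?X \<subseteq> {x. x ^ d = (- a / b) * x + (- c / b)}"
    proof clarify
      fix x :: 'a
      assume "vector [x, x ^ d, 1] \<in> l"
      from l[OF this] have "b * x ^ d = - a * x - c"
        by (simp add: algebra_simps eq_neg_iff_add_eq_0)
      then have "x ^ d = (- a * x - c) / b"
        using False by (metis nonzero_mult_div_cancel_left)
      then show "x ^ d = (- a / b) * x + (- c / b)"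
        by (simp add: diff_divide_distrib)
    qed
    then have "card ?X \<le> card {x. x ^ d = (- a / b) * x + (- c / b)}"
      by (intro card_mono) auto
    ultimately show ?thesis
      unfolding card using card_power_eq_linear_le[OF assms(2), of "- a / b" "- c / b"] by simp
  qed
qed

section \<open>Lower bounds from explicit lines, and the conclusion\<close>

lemma span_pair_in_pg_lines:
  assumes "s \<noteq> 0" "\<And>c. t \<noteq> c *s s"
  shows "vec.span {s, t} \<in> pg_lines"
proof -
  have "s \<noteq> t"
    using assms(2)[of 1] by auto
  moreover have "vec.independent {t, s}"
    using assms by (auto simp: vec.independent_insert vec.span_singleton)
  ultimately show ?thesis
    by (simp add: pg_lines_def vec.dim_eq_card_independent insert_commute)
qed

lemma card_line_le_deg_set:
  assumes "l \<in> pg_lines"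
  shows "card {P \<in> D. P \<subseteq> l} \<le> deg_set D"
  unfolding deg_set_def using assms
  by (intro Max_ge finite_u_num_nonzero) (auto simp only: u_num_nonzero_eq)

lemma deg_set_attained:
  obtains l where "l \<in> pg_lines" "deg_set D = card {P \<in> D. P \<subseteq> l}"
  using Max_in[OF finite_u_num_nonzero u_num_nonzero_nonempty, of D]
  unfolding deg_set_def u_num_nonzero_eq by blast

lemma deg_set_monom_ge_gcd:
  assumes "d \<ge> 2"
  shows "gcd d (CARD('a) - 1) \<le> deg_set (S_set (monom (1::'a::{field,finite}) d))"
proof -
  \<comment> \<open>The affine line \<open>y = 1\<close>, which meets the curve where
    \<open>x^d = 1\<close>.\<close>
  define l :: "('a ^ 3) set" where "l = vec.span {vector [1, 0, 0], vector [0, 1, 1]}"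
  have l: "l \<in> pg_lines"
    unfolding l_def by (intro span_pair_in_pg_lines) (auto simp: vec_eq_iff forall_3)
  have "vector [x, x ^ d, 1] \<in> l" if "x ^ d = 1" for x :: 'a
  proof -
    have "(vector [x, x ^ d, 1] :: 'a ^ 3) = x *s vector [1, 0, 0] + vector [0, 1, 1]"
      using that by (simp add: vec_eq_iff forall_3)
    then show ?thesis
      unfolding l_def by (simp only:) (intro vec.span_add vec.span_scale vec.span_base; simp)
  qed
  then have "card {x::'a. x ^ d = 1} \<le> card {x::'a. vector [x, x ^ d, 1] \<in> l}"
    by (intro card_mono) auto
  also have "\<dots> \<le> card {P \<in> S_set (monom 1 d). P \<subseteq> l}"
    using card_S_set_line[of l "monom 1 d"] l by (simp add: pg_lines_def poly_monom)
  also have "\<dots> \<le> deg_set (S_set (monom (1::'a) d))"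
    by (rule card_line_le_deg_set[OF l])
  finally show ?thesis
    using card_roots_of_unity_finite_field[of d, where 'a='a] assms by simp
qed

lemma deg_set_monom_ge_Suc_gcd:
  assumes "d \<ge> 2"
  shows "1 + gcd (d - 1) (CARD('a) - 1) \<le> deg_set (S_set (monom (1::'a::{field,finite}) d))"
proof -
  \<comment> \<open>The affine line \<open>y = x\<close>, which meets the curve at 0 and where
    \<open>x^(d-1) = 1\<close>.\<close>
  define l :: "('a ^ 3) set" where "l = vec.span {vector [1, 1, 0], vector [0, 0, 1]}"
  have l: "l \<in> pg_lines"
    unfolding l_def by (intro span_pair_in_pg_lines) (auto simp: vec_eq_iff forall_3)
  have d: "d = Suc (d - 1)"
    using assms by simp
  have "vector [x, x ^ d, 1] \<in> l" if "x \<in> insert 0 {x. x ^ (d - 1) = 1}" for x :: 'a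
  proof -
    have "x ^ d = x"
      using that assms by (subst d) (auto simp: power_0_left simp del: Suc_diff_1 Suc_pred)
    then have "(vector [x, x ^ d, 1] :: 'a ^ 3) = x *s vector [1, 1, 0] + vector [0, 0, 1]"
      by (simp add: vec_eq_iff forall_3)
    then show ?thesis
      unfolding l_def by (simp only:) (intro vec.span_add vec.span_scale vec.span_base; simp)
  qed
  then have "card (insert 0 {x::'a. x ^ (d - 1) = 1}) \<le> card {x::'a. vector [x, x ^ d, 1] \<in> l}"
    by (intro card_mono) auto
  also have "\<dots> \<le> card {P \<in> S_set (monom 1 d). P \<subseteq> l}"
    using card_S_set_line[of l "monom 1 d"] l by (simp add: pg_lines_def poly_monom)
  also have "\<dots> \<le> deg_set (S_set (monom (1::'a) d))"
    by (rule card_line_le_deg_set[OF l])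
  \<comment> \<open>As \<open>d - 1 > 0\<close>, 0 is not a root of unity and counts as an extra
    point.\<close>
  also have "card (insert 0 {x::'a. x ^ (d - 1) = 1}) = 1 + card {x::'a. x ^ (d - 1) = 1}"
    using assms by (simp add: power_0_left)
  finally show ?thesis
    using card_roots_of_unity_finite_field[of "d - 1", where 'a='a] assms by simp
qed

theorem theorem3p24:
  fixes d q :: nat
  assumes "q = CARD('a::{field,finite})"
    and "d \<ge> 2"
  shows "int (deg_set (S_set (monom (1::'a) d)))
           \<le> max (int (max (gcd d (q - 1)) (1 + gcd (d - 1) (q - 1))))
                 \<lfloor>1 / 2 + sqrt (real q - 1)\<rfloor>
         \<and> (\<lfloor>1 / 2 + sqrt (real q - 1)\<rfloor>
              \<le> int (max (gcd d (q - 1)) (1 + gcd (d - 1) (q - 1)))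
            \<longrightarrow> deg_set (S_set (monom (1::'a) d))
                  = max (gcd d (q - 1)) (1 + gcd (d - 1) (q - 1)))"
proof -
  obtain l :: "('a ^ 3) set" where "l \<in> pg_lines"
    and "deg_set (S_set (monom (1::'a) d)) = card {P \<in> S_set (monom 1 d). P \<subseteq> l}"
    using deg_set_attained by blast
  then have "int (deg_set (S_set (monom (1::'a) d)))
      \<le> max (int (max (gcd d (q - 1)) (1 + gcd (d - 1) (q - 1)))) \<lfloor>1 / 2 + sqrt (real q - 1)\<rfloor>"
    using card_S_set_monom_line_le[OF _ assms(2), of l] assms(1) by simp
  \<comment> \<open>This bound holds for all \<open>q\<close>; it meets the upper one as soon as the
    floor term does not dominate.\<close>
  moreover have "max (gcd d (q - 1)) (1 + gcd (d - 1) (q - 1)) \<le> deg_set (S_set (monom (1::'a) d))"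
    using deg_set_monom_ge_gcd[OF assms(2), where 'a='a]
      deg_set_monom_ge_Suc_gcd[OF assms(2), where 'a='a] assms(1) by simp
  ultimately show ?thesis
    by linarith
qed

end
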